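(* Suppose $\Lambda\in\mathcal F_0$ and that $\Lambda$ has a decreasing radial $L^1$-majorant $\Lambda_1$. Let $\nu\in M(\mathbb T)$ and let $\mu\in M(\mathbb R)$ be the measure defined by $\hat\mu(\xi)=W_{\hat\nu,\Lambda}(\xi)=\sum_{n\in\mathbb Z}\hat\nu(n)\Lambda(\xi-n)$. If $\nu$ is a continuous measure, then $\mu$ is a continuous measure.
   Context: $M(\mathbb R)$ and $M(\mathbb T)$ are the spaces of bounded regular (complex) Borel measures on $\mathbb R$ and on $\mathbb T$; $\mathbb T$ is identified with $[0,1)$. Fourier transforms are $\hat\mu(\xi)=\int_{\mathbb R}e^{-2\pi i\xi x}\,d\mu(x)$ for $\mu\in M(\mathbb R)$ and $\hat\nu(n)=\int_{\mathbb T}e^{-2\pi i n x}\,d\nu(x)$ for $\nu\in M(\mathbb T)$. A measure is continuous if it gives mass zero to every single point. $M_1(\mathbb R)$ denotes the Fourier multipliers of $L^1(\mathbb R)$ and $M_1(\mathbb Z)$ those of $L^1(\mathbb T)$, with operator norms; they are identified with $M(\mathbb R)$ and $M(\mathbb T)$ respectively (via $\mu\mapsto\hat\mu$, $\nu\mapsto\hat\nu$). $S_1^0(\mathbb R)$ is the set of $\Lambda\in L^\infty(\mathbb R)$ such that for each finitely supported $\phi\in M_1(\mathbb Z)$ the function $W_{\phi,\Lambda}(\xi)=\sum_{n\in\mathbb Z}\phi(n)\Lambda(\xi-n)$ belongs to $M_1(\mathbb R)$, and there is a constant $C_{1,\Lambda}$ (independent of $\phi$) with $\|W_{\phi,\Lambda}\|_{M_1(\mathbb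 R)}\le C_{1,\Lambda}\|\phi\|_{M_1(\mathbb Z)}$. $\mathcal F_0=\{\Lambda\in S_1^0(\mathbb R):\delta_\Lambda<\infty\}$, where $\delta_\Lambda=\operatorname{ess\,sup}_\xi\sum_{n\in\mathbb Z}|\Lambda(\xi+n)|$. For $\Lambda\in\mathcal F_0$ and $\nu\in M(\mathbb T)$ the series defining $W_{\hat\nu,\Lambda}$ converges a.e. and is (a.e. equal to) the Fourier transform of a measure in $M(\mathbb R)$. A decreasing radial $L^1$-majorant of $\Lambda$ is a function $\Lambda_1$ on $\mathbb R$ such that (a) $\Lambda_1$ is radial (i.e. $\Lambda_1(\xi)=\Lambda_1(|\xi|)$) and decreasing (in $|\xi|$); (b) $\Lambda_1\in L^1(\mathbb R)$; (c) $|\Lambda(\xi)|\le|\Lambda_1(|\xi|)|$. *)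

theory Defs
  imports "HOL-Analysis.Analysis" "HOL-Probability.Essential_Supremum"
begin

section \<open>Complex measures\<close>

text \<open>
  A complex measure on the measurable space \<open>M\<close> (the measure carried by \<open>M\<close> plays no role) is a
  countably additive complex-valued set function on \<open>sets M\<close>. It is automatically bounded, and a
  complex Borel measure on the real line or on \<open>[0, 1)\<close> is automatically regular. Values outside
  \<open>sets M\<close> are unconstrained and never used.
\<close>

definition complex_measure :: "'a measure \<Rightarrow> ('a set \<Rightarrow> complex) \<Rightarrow> bool" where
  "complex_measure M \<mu> \<longleftrightarrow>
     (\<forall>A :: nat \<Rightarrow> 'a set. range A \<subseteq> sets M \<longrightarrow> disjoint_family A \<longrightarrow>
        (\<lambda>n. \<mu> (A n)) sums \<mu> (\<Union>n. A n))"

text \<open>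
  The positive part \<open>\<sigma>\<^sup>+\<close> in the Jordan decomposition of a finite signed measure,
  \<open>\<sigma>\<^sup>+(E) = sup {\<sigma>(A) | A \<subseteq> E measurable}\<close>; the negative part of \<open>\<sigma>\<close> is the positive part of \<open>-\<sigma>\<close>.
  As \<open>\<sigma>({}) = 0\<close>, the truncation of negative values by \<open>ennreal\<close> does not change the supremum.
\<close>

definition jordan_pos :: "'a measure \<Rightarrow> ('a set \<Rightarrow> real) \<Rightarrow> 'a measure" where
  "jordan_pos M \<sigma> =
     measure_of (space M) (sets M) (\<lambda>E. SUP A\<in>{A \<in> sets M. A \<subseteq> E}. ennreal (\<sigma> A))"

definition complex_measure_integral ::
    "'a measure \<Rightarrow> ('a set \<Rightarrow> complex) \<Rightarrow> ('a \<Rightarrow> complex) \<Rightarrow> complex" where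
  "complex_measure_integral M \<mu> f =
     ((\<integral>x. f x \<partial>jordan_pos M (\<lambda>A. Re (\<mu> A))) - (\<integral>x. f x \<partial>jordan_pos M (\<lambda>A. - Re (\<mu> A))))
     + \<i> * ((\<integral>x. f x \<partial>jordan_pos M (\<lambda>A. Im (\<mu> A))) - (\<integral>x. f x \<partial>jordan_pos M (\<lambda>A. - Im (\<mu> A))))"

definition continuous_measure :: "'a measure \<Rightarrow> ('a set \<Rightarrow> complex) \<Rightarrow> bool" where
  "continuous_measure M \<mu> \<longleftrightarrow> (\<forall>x\<in>space M. \<mu> {x} = 0)"

text \<open>The circle is identified with \<open>[0, 1)\<close>.\<close>

abbreviation circle_borel :: "real measure" where
  "circle_borel \<equiv> restrict_space borel {0..<1}"

definition measures_R :: "(real set \<Rightarrow> complex) set" where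
  "measures_R = {\<mu>. complex_measure borel \<mu>}"

definition measures_T :: "(real set \<Rightarrow> complex) set" where
  "measures_T = {\<nu>. complex_measure circle_borel \<nu>}"

definition fourier_measure_R :: "(real set \<Rightarrow> complex) \<Rightarrow> real \<Rightarrow> complex" where
  "fourier_measure_R \<mu> \<xi> = complex_measure_integral borel \<mu> (\<lambda>x. cis (- 2 * pi * \<xi> * x))"

definition fourier_measure_T :: "(real set \<Rightarrow> complex) \<Rightarrow> int \<Rightarrow> complex" where
  "fourier_measure_T \<nu> n =
     complex_measure_integral circle_borel \<nu> (\<lambda>x. cis (- 2 * pi * of_int n * x))"

section \<open>Fourier multipliers of \<open>L\<^sup>1\<close>\<close>

text \<open>
  \<open>L\<^sup>1\<close> and \<open>L\<^sup>\<infinity>\<close> are handled through representatives; all notions below are invariant under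
  changes on Lebesgue null sets.
\<close>

definition fourier_R :: "(real \<Rightarrow> complex) \<Rightarrow> real \<Rightarrow> complex" where
  "fourier_R f \<xi> = (\<integral>x. cis (- 2 * pi * \<xi> * x) * f x \<partial>lebesgue)"

definition fourier_T :: "(real \<Rightarrow> complex) \<Rightarrow> int \<Rightarrow> complex" where
  "fourier_T f n = (\<integral>x. cis (- 2 * pi * of_int n * x) * f x \<partial>lebesgue_on {0..<1})"

definition L_infinity :: "(real \<Rightarrow> complex) set" where
  "L_infinity = {f. f \<in> borel_measurable lebesgue \<and> (\<exists>C. AE x in lebesgue. norm (f x) \<le> C)}"

text \<open>
  \<open>multiplier_bound_R m C\<close>: the operator \<open>f \<mapsto> g\<close> with \<open>\<hat>g = m \<hat>f\<close> maps \<open>L\<^sup>1\<close> to \<open>L\<^sup>1\<close> with norm at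
  most \<open>C\<close>. By uniqueness of Fourier transforms \<open>g\<close> is determined by \<open>f\<close> up to null sets.
\<close>

definition multiplier_bound_R :: "(real \<Rightarrow> complex) \<Rightarrow> real \<Rightarrow> bool" where
  "multiplier_bound_R m C \<longleftrightarrow> 0 \<le> C \<and>
     (\<forall>f. integrable lebesgue f \<longrightarrow>
        (\<exists>g. integrable lebesgue g \<and> (AE \<xi> in lebesgue. fourier_R g \<xi> = m \<xi> * fourier_R f \<xi>) \<and>
             (\<integral>x. norm (g x) \<partial>lebesgue) \<le> C * (\<integral>x. norm (f x) \<partial>lebesgue)))"

definition multiplier_bound_Z :: "(int \<Rightarrow> complex) \<Rightarrow> real \<Rightarrow> bool" where
  "multiplier_bound_Z \<phi> C \<longleftrightarrow> 0 \<le> C \<and>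
     (\<forall>f. integrable (lebesgue_on {0..<1}) f \<longrightarrow>
        (\<exists>g. integrable (lebesgue_on {0..<1}) g \<and> (\<forall>n. fourier_T g n = \<phi> n * fourier_T f n) \<and>
             (\<integral>x. norm (g x) \<partial>lebesgue_on {0..<1}) \<le> C * (\<integral>x. norm (f x) \<partial>lebesgue_on {0..<1})))"

definition M1_R :: "(real \<Rightarrow> complex) set" where
  "M1_R = {m \<in> L_infinity. \<exists>C. multiplier_bound_R m C}"

definition M1_Z :: "(int \<Rightarrow> complex) set" where
  "M1_Z = {\<phi>. bounded (range \<phi>) \<and> (\<exists>C. multiplier_bound_Z \<phi> C)}"

definition M1_norm_R :: "(real \<Rightarrow> complex) \<Rightarrow> real" where
  "M1_norm_R m = Inf {C. multiplier_bound_R m C}"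

definition M1_norm_Z :: "(int \<Rightarrow> complex) \<Rightarrow> real" where
  "M1_norm_Z \<phi> = Inf {C. multiplier_bound_Z \<phi> C}"

section \<open>The classes \<open>S\<^sub>1\<^sup>0(\<real>)\<close> and \<open>\<F>\<^sub>0\<close>\<close>

text \<open>
  The series is summed unconditionally. The default value of \<open>infsum\<close> is irrelevant in the uses
  below: either \<open>\<phi>\<close> has finite support, or \<open>\<phi>\<close> is bounded and \<open>\<delta> \<Lambda> < \<infinity>\<close>, in which case the series
  converges absolutely for almost every \<open>\<xi>\<close>.
\<close>

definition W :: "(int \<Rightarrow> complex) \<Rightarrow> (real \<Rightarrow> complex) \<Rightarrow> real \<Rightarrow> complex" where
  "W \<phi> \<Lambda> \<xi> = (\<Sum>\<^sub>\<infinity>n\<in>UNIV. \<phi> n * \<Lambda> (\<xi> - of_int n))"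

definition S10 :: "(real \<Rightarrow> complex) set" where
  "S10 = {\<Lambda> \<in> L_infinity. \<exists>C. \<forall>\<phi>\<in>M1_Z. finite {n. \<phi> n \<noteq> 0} \<longrightarrow>
            W \<phi> \<Lambda> \<in> M1_R \<and> M1_norm_R (W \<phi> \<Lambda>) \<le> C * M1_norm_Z \<phi>}"

definition \<delta> :: "(real \<Rightarrow> complex) \<Rightarrow> ennreal" where
  "\<delta> \<Lambda> = esssup lebesgue (\<lambda>\<xi>. \<Sum>\<^sub>\<infinity>n\<in>(UNIV :: int set). ennreal (norm (\<Lambda> (\<xi> + of_int n))))"

definition F0 :: "(real \<Rightarrow> complex) set" where
  "F0 = {\<Lambda> \<in> S10. \<delta> \<Lambda> < \<infinity>}"

text \<open>
  As \<open>\<Lambda>\<close> is an element of \<open>L\<^sup>\<infinity>\<close>, the domination by \<open>\<Lambda>1\<close> is required almost everywhere.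
\<close>

definition decreasing_radial_L1_majorant :: "(real \<Rightarrow> complex) \<Rightarrow> (real \<Rightarrow> real) \<Rightarrow> bool" where
  "decreasing_radial_L1_majorant \<Lambda> \<Lambda>1 \<longleftrightarrow>
     (\<forall>\<xi>. \<Lambda>1 \<xi> = \<Lambda>1 \<bar>\<xi>\<bar>) \<and> antimono_on {0..} \<Lambda>1 \<and>
     integrable lebesgue \<Lambda>1 \<and>
     (AE \<xi> in lebesgue. norm (\<Lambda> \<xi>) \<le> \<bar>\<Lambda>1 \<bar>\<xi>\<bar>\<bar>)"

end

theory Submission
  imports Defs "HOL-Probability.Probability_Measure"
begin

text \<open>
  The point mass \<open>\<mu>{x}\<close> is the limit of the averages of \<open>exp(2\<pi>ix\<xi>) \<mu>^(\<xi>)\<close> over \<open>[0, N)\<close>, so it is enough that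
  the averages of \<open>|\<mu>^|\<close> tend to \<open>0\<close>. As \<open>|\<mu>^(\<xi>)| \<le> \<Sum>n. |\<nu>^(n)| |\<Lambda>(\<xi> - n)|\<close>, the average over \<open>[0, N)\<close> is at
  most \<open>\<integral> |\<Lambda>(y)| A\<^sub>N(\<lfloor>y\<rfloor>) dy\<close> with \<open>A\<^sub>N(k)\<close> the mean of \<open>|\<nu>^(j - k)|\<close> over \<open>0 \<le> j < N\<close>. By Wiener's lemma
  and Cauchy-Schwarz \<open>A\<^sub>N(k) \<rightarrow> 0\<close> for every \<open>k\<close>, and dominated convergence applies because the
  majorant makes \<open>\<Lambda>\<close> integrable.
\<close>

section \<open>Jordan decomposition\<close>

text \<open>Real-valued counterpart of \<open>complex_measure\<close>. As a locale it can be
  interpreted for the real part, the imaginary part and the negatives of both.\<close>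

locale signed_measure =
  fixes M :: "'a measure" and \<sigma> :: "'a set \<Rightarrow> real"
  assumes sums_UN: "range A \<subseteq> sets M \<Longrightarrow> disjoint_family A \<Longrightarrow> (\<lambda>n::nat. \<sigma> (A n)) sums \<sigma> (\<Union>n. A n)"
begin

lemma empty [simp]: "\<sigma> {} = 0"
proof -
  \<comment> \<open>Countable additivity for the constant family of empty sets: a constant series
    converges only if the constant is 0.\<close>
  have "(\<lambda>n::nat. \<sigma> {}) sums \<sigma> {}"
    using sums_UN[of "\<lambda>_. {}"] by (simp add: disjoint_family_on_def)
  then have "summable (\<lambda>n::nat. \<sigma> {})" by (rule sums_summable)
  then show ?thesis by (simp add: summable_const_iff)
qed

lemma Un_disjoint:
  assumes "A \<in> sets M" "B \<in> sets M" "A \<inter> B = {}"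
  shows "\<sigma> (A \<union> B) = \<sigma> A + \<sigma> B"
proof -
  have "(\<lambda>n. \<sigma> (binaryset A B n)) sums \<sigma> (A \<union> B)"
  proof -
    have "disjoint_family (binaryset A B)"
      using assms(3) by (auto simp: disjoint_family_on_def binaryset_def)
    then show ?thesis
      using sums_UN[of "binaryset A B"] assms by (simp add: range_binaryset_eq UN_binaryset_eq)
  qed
  moreover have "(\<lambda>n. \<sigma> (binaryset A B n)) sums (\<sigma> A + \<sigma> B)"
    by (rule binaryset_sums) simp
  ultimately show ?thesis by (rule sums_unique2)
qed

lemma Diff:
  assumes "A \<in> sets M" "B \<in> sets M" "A \<subseteq> B"
  shows "\<sigma> (B - A) = \<sigma> B - \<sigma> A"
proof -
  have "A \<union> (B - A) = B" using assms by auto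
  then show ?thesis using Un_disjoint[of A "B - A"] assms by simp
qed

text \<open>Makes every fact on positive parts available for negative parts.\<close>

lemma uminus: "signed_measure M (\<lambda>A. - \<sigma> A)"
  by unfold_locales (intro sums_minus sums_UN)

section \<open>Boundedness of finite signed measures\<close>

definition unbounded_on :: "'a set \<Rightarrow> bool" where
  "unbounded_on E \<longleftrightarrow> (\<forall>K. \<exists>A\<in>sets M. A \<subseteq> E \<and> \<bar>\<sigma> A\<bar> > K)"

text \<open>If \<open>\<sigma>\<close> were bounded on the subsets of \<open>A\<close> and of
  \<open>E - A\<close>, adding the bounds would bound it on those of \<open>E\<close>. So one half
  stays unbounded, and the other half is split off.\<close>

lemma unbounded_on_split:
  assumes E: "E \<in> sets M" "unbounded_on E"
  shows "\<exists>A\<in>sets M. A \<subseteq> E \<and> \<bar>\<sigma> A\<bar> > 1 \<and> unbounded_on (E - A)"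
proof -
  \<comment> \<open>The margin \<open>1 + \<bar>\<sigma> E\<bar>\<close> forces \<open>E - A\<close>
    to have mass above 1 in absolute value as well, so either half may be the one split off.\<close>
  obtain A where A: "A \<in> sets M" "A \<subseteq> E" "\<bar>\<sigma> A\<bar> > 1 + \<bar>\<sigma> E\<bar>"
    using E(2) unfolding unbounded_on_def by blast
  have B: "E - A \<in> sets M" "\<bar>\<sigma> (E - A)\<bar> > 1"
    using A E Diff[of A E] by auto
  have "unbounded_on A \<or> unbounded_on (E - A)"
  proof (rule ccontr)
    assume "\<not> ?thesis"
    then obtain K L where KL: "\<And>C. C \<in> sets M \<Longrightarrow> C \<subseteq> A \<Longrightarrow> \<bar>\<sigma> C\<bar> \<le> K"
      "\<And>C. C \<in> sets M \<Longrightarrow> C \<subseteq> E - A \<Longrightarrow> \<bar>\<sigma> C\<bar> \<le> L"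
      unfolding unbounded_on_def by (meson not_le)
    obtain C where C: "C \<in> sets M" "C \<subseteq> E" "\<bar>\<sigma> C\<bar> > K + L"
      using E(2) unfolding unbounded_on_def by blast
    have "\<sigma> C = \<sigma> (C \<inter> A) + \<sigma> (C - A)"
      using Un_disjoint[of "C \<inter> A" "C - A"] C A by (simp add: Int_Diff_Un Int_Diff_disjoint)
    moreover have "\<bar>\<sigma> (C \<inter> A)\<bar> \<le> K" "\<bar>\<sigma> (C - A)\<bar> \<le> L"
      using C A by (auto intro!: KL)
    ultimately show False using C by linarith
  qed
  then show ?thesis
  proof
    assume "unbounded_on A"
    moreover have "E - (E - A) = A" using A by auto
    ultimately show ?thesis using B by (intro bexI[of _ "E - A"]) auto
  qed (use A in auto)
qed

text \<open>Otherwise one could split off infinitely many disjoint sets of mass at least \<open>1\<close>.\<close>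

lemma bounded: "\<exists>K. \<forall>A\<in>sets M. \<bar>\<sigma> A\<bar> \<le> K"
proof (rule ccontr)
  assume "\<not> ?thesis"
  then have unb: "unbounded_on (space M)"
    unfolding unbounded_on_def by (simp add: not_le) (metis sets.sets_into_space)
  define Q where "Q E \<longleftrightarrow> E \<in> sets M \<and> unbounded_on E" for E
  define R where "R E F \<longleftrightarrow> F \<subseteq> E \<and> \<bar>\<sigma> (E - F)\<bar> > 1" for E F
  have step: "\<exists>F. Q F \<and> R E F" if E: "Q E" for E
  proof -
    obtain A where "A \<in> sets M" "A \<subseteq> E" "\<bar>\<sigma> A\<bar> > 1" "unbounded_on (E - A)"
      using unbounded_on_split[of E] E unfolding Q_def by blast
    moreover from this have "E - (E - A) = A" by auto
    ultimately show ?thesis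
      using E unfolding Q_def R_def by (intro exI[of _ "E - A"]) auto
  qed
  obtain E where E: "\<And>n. Q (E n)" "\<And>n. R (E n) (E (Suc n))"
  proof -
    have "\<exists>E. \<forall>n. Q (E n) \<and> R (E n) (E (Suc n))"
    proof (rule dependent_nat_choice)
      show "\<exists>E. Q E" using unb unfolding Q_def by blast
      show "\<exists>F. Q F \<and> R E F" if "Q E" for E and n :: nat using that by (rule step)
    qed
    then show ?thesis using that by blast
  qed
  have dec: "decseq E" using E(2) unfolding R_def by (auto intro: decseq_SucI)
  define D where "D n = E n - E (Suc n)" for n
  have "disjoint_family D"
    unfolding disjoint_family_on_def
  proof (intro ballI impI)
    have less: "D i \<inter> D j = {}" if "i < j" for i j
    proof -
      have "E j \<subseteq> E (Suc i)" using dec that unfolding decseq_def by auto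
      then show ?thesis unfolding D_def by auto
    qed
    show "D i \<inter> D j = {}" if "i \<noteq> j" for i j
      using less[of i j] less[of j i] that by (cases "i < j") auto
  qed
  moreover have "range D \<subseteq> sets M" using E(1) unfolding D_def Q_def by auto
  ultimately have "(\<lambda>n. \<sigma> (D n)) sums \<sigma> (\<Union>n. D n)" by (intro sums_UN)
  \<comment> \<open>Terms of a convergent series tend to 0, whereas each \<open>D n\<close> has mass
    above 1 in absolute value.\<close>
  then have "(\<lambda>n. \<sigma> (D n)) \<longlonglongrightarrow> 0"
    using summable_LIMSEQ_zero sums_summable by blast
  then obtain n where "\<bar>\<sigma> (D n)\<bar> < 1"
    using LIMSEQ_D[of _ 0 1] by fastforce
  moreover have "\<bar>\<sigma> (D n)\<bar> > 1" using E(2) unfolding R_def D_def by auto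
  ultimately show False by simp
qed

section \<open>The positive part is a finite measure\<close>

definition pos :: "'a set \<Rightarrow> ennreal" where
  "pos E = (SUP A\<in>{A \<in> sets M. A \<subseteq> E}. ennreal (\<sigma> A))"

lemma pos_upper: "A \<in> sets M \<Longrightarrow> A \<subseteq> E \<Longrightarrow> ennreal (\<sigma> A) \<le> pos E"
  unfolding pos_def by (intro SUP_upper) auto

text \<open>Measurable subsets of \<open>E\<close> and of \<open>F\<close> combine to a disjoint
  union inside \<open>E \<union> F\<close>, on which \<open>\<sigma>\<close> adds up.\<close>

lemma pos_superadditive:
  assumes "E \<inter> F = {}"
  shows "pos E + pos F \<le> pos (E \<union> F)"
proof -
  have *: "ennreal (\<sigma> A) + ennreal (\<sigma> B) \<le> pos (E \<union> F)"
    if A: "A \<in> sets M" "A \<subseteq> E" and B: "B \<in> sets M" "B \<subseteq> F" for A B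
  proof (cases "\<sigma> A \<ge> 0 \<and> \<sigma> B \<ge> 0")
    case True
    then have "ennreal (\<sigma> A) + ennreal (\<sigma> B) = ennreal (\<sigma> (A \<union> B))"
      using A B assms by (subst Un_disjoint) (auto simp: ennreal_plus)
    also have "\<dots> \<le> pos (E \<union> F)" using A B by (intro pos_upper) auto
    finally show ?thesis .
  next
    case False
    \<comment> \<open>A negative value is truncated to 0 by \<open>ennreal\<close>, so the other set
      alone gives the bound.\<close>
    then show ?thesis
      using pos_upper[of A "E \<union> F"] pos_upper[of B "E \<union> F"] A B
      by (auto simp: ennreal_neg le_supI1 le_supI2 not_le)
  qed
  have ne: "{A \<in> sets M. A \<subseteq> E} \<noteq> {}" for E by auto
  have "pos E + pos F = (SUP A\<in>{A \<in> sets M. A \<subseteq> E}. SUP B\<in>{A \<in> sets M. A \<subseteq> F}. ennreal (\<sigma> A) + ennreal (\<sigma> B))"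
    unfolding pos_def using ne
    by (subst ennreal_SUP_add_left[symmetric]) (auto simp: ennreal_SUP_add_right simp del: Collect_empty_eq)
  also have "\<dots> \<le> pos (E \<union> F)" by (intro SUP_least) (auto intro: *)
  finally show ?thesis .
qed

text \<open>One inequality follows from superadditivity on finite unions and monotonicity. For the
  other, each competitor \<open>A\<close> in the supremum is cut into the pieces
  \<open>A \<inter> E i\<close>, to which countable additivity of \<open>\<sigma>\<close>
  applies.\<close>

lemma countably_additive_pos: "countably_additive (sets M) pos"
proof (rule countably_additiveI)
  fix E :: "nat \<Rightarrow> 'a set"
  assume E: "range E \<subseteq> sets M" "disjoint_family E" "(\<Union>i. E i) \<in> sets M"
  show "(\<Sum>i. pos (E i)) = pos (\<Union>i. E i)"
  proof (rule antisym)
    have "(\<Sum>i<n. pos (E i)) \<le> pos (\<Union>i<n. E i)" for n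
    proof (induction n)
      case (Suc n)
      have "E n \<inter> (\<Union>i<n. E i) = {}"
        using disjoint_family_onD[OF E(2), of n] by (auto simp: disjoint_iff)
      then have "pos (E n) + pos (\<Union>i<n. E i) \<le> pos (\<Union>i<Suc n. E i)"
        using pos_superadditive[of "E n" "\<Union>i<n. E i"] by (simp only: lessThan_Suc UN_insert)
      moreover have "(\<Sum>i<Suc n. pos (E i)) \<le> pos (E n) + pos (\<Union>i<n. E i)"
        using add_left_mono[OF Suc.IH] by (simp add: add.commute)
      ultimately show ?case by (rule order_trans[rotated])
    qed auto
    also have "pos (\<Union>i<n. E i) \<le> pos (\<Union>i. E i)" for n
      unfolding pos_def by (intro SUP_subset_mono) auto
    finally show "(\<Sum>i. pos (E i)) \<le> pos (\<Union>i. E i)"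
      by (intro suminf_le_const) auto
    show "pos (\<Union>i. E i) \<le> (\<Sum>i. pos (E i))"
      unfolding pos_def[of "\<Union>i. E i"]
    proof (rule SUP_least)
      fix A assume "A \<in> {A \<in> sets M. A \<subseteq> (\<Union>i. E i)}"
      then have A: "A \<in> sets M" "A = (\<Union>i. A \<inter> E i)" by auto
      have "(\<lambda>i. \<sigma> (A \<inter> E i)) sums \<sigma> (\<Union>i. A \<inter> E i)"
        using A(1) E by (intro sums_UN) (auto simp: disjoint_family_on_def)
      then have "(\<lambda>n. ennreal (\<Sum>i<n. \<sigma> (A \<inter> E i))) \<longlonglongrightarrow> ennreal (\<sigma> A)"
        using A(2) by (auto simp: sums_def intro: tendsto_ennrealI)
      then show "ennreal (\<sigma> A) \<le> (\<Sum>i. pos (E i))"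
      proof (rule LIMSEQ_le_const2, intro exI allI impI)
        fix n
        \<comment> \<open>The pieces may have either sign; they are replaced by their positive parts
          before \<open>ennreal\<close> is moved inside the sum.\<close>
        have "ennreal (\<Sum>i<n. \<sigma> (A \<inter> E i)) \<le> ennreal (\<Sum>i<n. max 0 (\<sigma> (A \<inter> E i)))"
          by (intro ennreal_leI sum_mono) auto
        also have "\<dots> = (\<Sum>i<n. ennreal (\<sigma> (A \<inter> E i)))"
          by (simp flip: sum_ennreal add: ennreal_max_0)
        also have "\<dots> \<le> (\<Sum>i<n. pos (E i))"
          using A(1) E(1) by (intro sum_mono pos_upper) auto
        also have "\<dots> \<le> (\<Sum>i. pos (E i))"
          by (intro sum_le_suminf) auto
        finally show "ennreal (\<Sum>i<n. \<sigma> (A \<inter> E i)) \<le> (\<Sum>i. pos (E i))" .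
      qed
    qed
  qed
qed

lemma sets_jordan_pos [simp, measurable_cong]: "sets (jordan_pos M \<sigma>) = sets M"
  by (simp add: jordan_pos_def sets.sets_measure_of_eq)

lemma space_jordan_pos [simp]: "space (jordan_pos M \<sigma>) = space M"
  by (rule sets_eq_imp_space_eq) simp

lemma jordan_pos_eq: "jordan_pos M \<sigma> = measure_of (space M) (sets M) pos"
  unfolding jordan_pos_def pos_def[abs_def] ..

lemma pos_empty [simp]: "pos {} = 0"
  by (simp add: pos_def cong: conj_cong)

text \<open>\<open>measure_of\<close> returns the given set function only when that is a measure,
  which is what countable additivity of \<open>pos\<close> secures.\<close>

lemma emeasure_jordan_pos: "E \<in> sets M \<Longrightarrow> emeasure (jordan_pos M \<sigma>) E = pos E"
  unfolding jordan_pos_eq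
  by (intro emeasure_measure_of_sigma sets.sigma_algebra_axioms countably_additive_pos) (auto simp: positive_def)

lemma finite_measure_jordan_pos: "finite_measure (jordan_pos M \<sigma>)"
proof
  obtain K where "\<forall>A\<in>sets M. \<bar>\<sigma> A\<bar> \<le> K" using bounded by blast
  then have "pos (space M) \<le> ennreal K"
    unfolding pos_def by (intro SUP_least ennreal_leI) auto
  then show "emeasure (jordan_pos M \<sigma>) (space (jordan_pos M \<sigma>)) \<noteq> \<infinity>"
    by (auto simp: emeasure_jordan_pos top_unique)
qed

end

text \<open>Complements replace a Hahn decomposition: for \<open>A \<subseteq> E\<close>,
  \<open>\<sigma> A = \<sigma> E - \<sigma> (E - A)\<close>, so the supremum of
  \<open>\<sigma>\<close> over such \<open>A\<close> is \<open>\<sigma> E\<close> plus the supremum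
  of \<open>- \<sigma>\<close>.\<close>

lemma (in signed_measure) jordan_decomposition:
  assumes E: "E \<in> sets M"
  shows "\<sigma> E = measure (jordan_pos M \<sigma>) E - measure (jordan_pos M (\<lambda>A. - \<sigma> A)) E"
proof -
  interpret n: signed_measure M "\<lambda>A. - \<sigma> A" by (rule uminus)
  interpret P: finite_measure "jordan_pos M \<sigma>" by (rule finite_measure_jordan_pos)
  interpret N: finite_measure "jordan_pos M (\<lambda>A. - \<sigma> A)" by (rule n.finite_measure_jordan_pos)
  define p where "p = measure (jordan_pos M \<sigma>) E"
  define q where "q = measure (jordan_pos M (\<lambda>A. - \<sigma> A)) E"
  have p: "pos E = ennreal p" and q: "n.pos E = ennreal q"
    using E unfolding p_def q_def
    by (simp_all flip: emeasure_jordan_pos n.emeasure_jordan_pos add: P.emeasure_eq_measure N.emeasure_eq_measure)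
  have pq: "p \<ge> 0" "q \<ge> 0" unfolding p_def q_def by auto
  have le_p: "\<sigma> A \<le> p" if "A \<in> sets M" "A \<subseteq> E" for A
    using pos_upper[OF that] pq unfolding p by (auto simp: ennreal_le_iff2)
  have le_q: "- \<sigma> A \<le> q" if "A \<in> sets M" "A \<subseteq> E" for A
    using n.pos_upper[OF that] pq unfolding q by (auto simp: ennreal_le_iff2)
  have "\<sigma> A \<le> \<sigma> E + q" if "A \<in> sets M" "A \<subseteq> E" for A
    using le_q[of "E - A"] Diff[of A E] that E by auto
  then have "pos E \<le> ennreal (\<sigma> E + q)"
    unfolding pos_def by (intro SUP_least ennreal_leI) auto
  \<comment> \<open>Nonnegativity of the bound turns the comparison of \<open>ennreal\<close> values
    back into one of reals.\<close>
  moreover have "0 \<le> \<sigma> E + q" using le_q[of E] E by auto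
  ultimately have 1: "p \<le> \<sigma> E + q" unfolding p by (simp add: ennreal_le_iff)
  have "- \<sigma> A \<le> p - \<sigma> E" if "A \<in> sets M" "A \<subseteq> E" for A
    using le_p[of "E - A"] Diff[of A E] that E by auto
  then have "n.pos E \<le> ennreal (p - \<sigma> E)"
    unfolding n.pos_def by (intro SUP_least ennreal_leI) auto
  moreover have "0 \<le> p - \<sigma> E" using le_p[of E] E by auto
  ultimately have 2: "q \<le> p - \<sigma> E" unfolding q by (simp add: ennreal_le_iff)
  show ?thesis using 1 2 unfolding p_def q_def by linarith
qed

text \<open>A singleton has only itself and the empty set as subsets, so the two Jordan parts cannot
  cancel there: the parts of a continuous measure are continuous.\<close>

lemma (in signed_measure) measure_jordan_pos_singleton:
  assumes "\<sigma> {x} = 0" "{x} \<in> sets M"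
  shows "measure (jordan_pos M \<sigma>) {x} = 0"
proof -
  have "pos {x} \<le> 0"
    unfolding pos_def using assms by (intro SUP_least) (auto simp: subset_singleton_iff)
  then show ?thesis
    using assms by (simp add: measure_def emeasure_jordan_pos)
qed

lemma complex_measure_signed:
  assumes "complex_measure M \<mu>"
  shows "signed_measure M (\<lambda>A. Re (\<mu> A))" "signed_measure M (\<lambda>A. Im (\<mu> A))"
  using assms by (auto simp: complex_measure_def sums_complex_iff signed_measure_def)

section \<open>Wiener's lemma on the circle\<close>

lemma cis_eq_1_iff: "cis a = 1 \<longleftrightarrow> (\<exists>n::int. a = of_int n * (2 * pi))"
  by (auto simp: cis_conv_exp exp_eq_1 algebra_simps)

lemma borel_measurable_cis [measurable]:
  "f \<in> borel_measurable M \<Longrightarrow> (\<lambda>x. cis (f x)) \<in> borel_measurable M"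
  by (rule measurable_compose[where g = cis])
     (auto intro!: borel_measurable_continuous_onI continuous_intros)

text \<open>The geometric sum is at most \<open>2 / norm (1 - cis t)\<close> for every
  \<open>N\<close>, and it is divided by \<open>N\<close>. The shift \<open>k\<close> only
  contributes a factor of modulus 1.\<close>

lemma cis_average_tendsto_0:
  assumes "cis t \<noteq> 1"
  shows "(\<lambda>N. (\<Sum>j<N. cis (of_int (int j - k) * t)) / of_nat N) \<longlonglongrightarrow> 0"
proof (rule Lim_null_comparison)
  define c where "c = 2 / norm (1 - cis t)"
  have "(\<Sum>j<N. cis (of_int (int j - k) * t)) = cis (- of_int k * t) * ((1 - cis t ^ N) / (1 - cis t))" for N
  proof -
    have "(\<Sum>j<N. cis (of_int (int j - k) * t)) = (\<Sum>j<N. cis (- of_int k * t) * cis t ^ j)"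
      by (simp only: Complex.DeMoivre cis_mult) (simp add: algebra_simps)
    then show ?thesis
      using assms by (simp flip: sum_distrib_left add: sum_gp_strict)
  qed
  moreover have "norm (1 - cis t ^ N) \<le> 2" for N
    using norm_triangle_ineq4[of 1 "cis t ^ N"] by (simp add: norm_power)
  ultimately have "norm (\<Sum>j<N. cis (of_int (int j - k) * t)) \<le> c" for N
    by (simp add: c_def norm_mult norm_divide divide_right_mono)
  then show "\<forall>\<^sub>F N in sequentially. norm ((\<Sum>j<N. cis (of_int (int j - k) * t)) / of_nat N) \<le> c / real N"
    by (intro always_eventually allI) (simp add: norm_divide divide_right_mono)
  show "(\<lambda>N. c / real N) \<longlonglongrightarrow> 0"
    by (rule lim_const_over_n)
qed

lemma norm_average_le:
  fixes f :: "nat \<Rightarrow> 'a::real_normed_field"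
  assumes "\<And>j. norm (f j) \<le> c" "c \<ge> 0"
  shows "norm ((\<Sum>j<N. f j) / of_nat N) \<le> c"
proof (cases "N = 0")
  case False
  have "norm (\<Sum>j<N. f j) \<le> c * real N"
    using sum_norm_le[of "{..<N}" f "\<lambda>_. c"] assms by (simp add: mult.commute)
  then show ?thesis using False by (simp add: norm_divide divide_le_eq)
qed (use assms in auto)

text \<open>Cauchy-Schwarz against the constant sequence 1.\<close>

lemma average_le_sqrt_average:
  fixes a :: "nat \<Rightarrow> real"
  shows "(\<Sum>j<N. a j) / real N \<le> sqrt ((\<Sum>j<N. (a j)\<^sup>2) / real N)"
proof (rule real_le_rsqrt)
  show "((\<Sum>j<N. a j) / real N)\<^sup>2 \<le> (\<Sum>j<N. (a j)\<^sup>2) / real N"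
    using sum_squared_le_sum_of_squares[of a "{..<N}"]
    by (cases "N = 0") (auto simp: power_divide divide_simps power2_eq_square)
qed

definition ft :: "real measure \<Rightarrow> real \<Rightarrow> complex" where
  "ft P \<xi> = (\<integral>x. cis (- 2 * pi * \<xi> * x) \<partial>P)"

text \<open>Measurability of the identity is what measures on \<open>borel\<close> and on
  \<open>circle_borel\<close> have in common, so both kinds of Jordan parts are covered.\<close>

context
  fixes P :: "real measure"
  assumes fin: "finite_measure P" and meas: "(\<lambda>x. x) \<in> borel_measurable P"
begin

lemma norm_ft_le: "norm (ft P \<xi>) \<le> measure P (space P)"
proof -
  interpret finite_measure P by (rule fin)
  note [measurable] = meas
  have "norm (ft P \<xi>) \<le> (\<integral>x. norm (cis (- 2 * pi * \<xi> * x)) \<partial>P)"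
    unfolding ft_def by (rule integral_norm_bound)
  then show ?thesis by simp
qed

lemma integrable_cis: "integrable P (\<lambda>x. cis (a * x))"
proof -
  interpret finite_measure P by (rule fin)
  note [measurable] = meas
  show ?thesis by (rule integrable_const_bound[where B = 1]) auto
qed

lemma cnj_ft: "cnj (ft P \<xi>) = (\<integral>x. cis (2 * pi * \<xi> * x) \<partial>P)"
  unfolding ft_def by (subst Bochner_Integration.integral_cnj[symmetric]) (simp add: cis_cnj)

text \<open>The mean square of the Fourier coefficients is a double integral of a Dirichlet kernel, which
  is bounded by \<open>1\<close> and converges to \<open>0\<close> off the diagonal.\<close>

lemma wiener_mean_square:
  assumes circle: "space P \<subseteq> {0..<1}"
    and atomless: "\<And>x. x \<in> space P \<Longrightarrow> {x} \<in> sets P \<and> measure P {x} = 0"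
  shows "(\<lambda>N. (\<Sum>j<N. (norm (ft P (of_int (int j - k))))\<^sup>2) / real N) \<longlonglongrightarrow> 0"
proof -
  interpret finite_measure P by (rule fin)
  note [measurable] = meas
  define m where "m j = real_of_int (int j - k)" for j :: nat
  define D where "D N x y = (\<Sum>j<N. cis (of_int (int j - k) * (2 * pi * (y - x)))) / of_nat N" for N :: nat and x y
  define I where "I N x = (\<integral>y. D N x y \<partial>P)" for N x
  \<comment> \<open>The inner integral is a trigonometric polynomial in \<open>x\<close>, so the
    double integral is evaluated term by term, without Fubini.\<close>
  have I_eq: "I N x = (\<Sum>j<N. cis (- 2 * pi * m j * x) * cnj (ft P (m j))) / of_nat N" for N x
  proof -
    have "D N x = (\<lambda>y. (\<Sum>j<N. cis (- 2 * pi * m j * x) * cis (2 * pi * m j * y)) / of_nat N)"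
      by (rule ext) (simp add: D_def m_def cis_mult algebra_simps)
    then show ?thesis
      unfolding I_def cnj_ft by (simp add: integrable_cis)
  qed
  have D_le: "norm (D N x y) \<le> 1" for N x y
    unfolding D_def by (rule norm_average_le) auto
  have D_meas [measurable]: "D N x \<in> borel_measurable P" for N x
    unfolding D_def[abs_def] by measurable
  have I_lim: "(\<lambda>N. I N x) \<longlonglongrightarrow> 0" if x: "x \<in> space P" for x
  proof -
    \<comment> \<open>The kernel equals 1 at \<open>y = x\<close> for \<open>N > 0\<close> and tends
      to 0 elsewhere. The diagonal point is null, so the limit integral vanishes.\<close>
    have "(\<lambda>N. I N x) \<longlonglongrightarrow> (\<integral>y. complex_of_real (indicator {x} y) \<partial>P)"
      unfolding I_def
    proof (rule integral_dominated_convergence[where w = "\<lambda>_. 1"])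
      show "AE y in P. (\<lambda>N. D N x y) \<longlonglongrightarrow> complex_of_real (indicator {x} y)"
      proof (rule AE_mp[OF AE_not_in[of "{x}"]])
        show "{x} \<in> null_sets P"
          using atomless[OF x] by (auto simp: null_sets_def emeasure_eq_measure)
        show "AE y in P. y \<notin> {x} \<longrightarrow> (\<lambda>N. D N x y) \<longlonglongrightarrow> complex_of_real (indicator {x} y)"
        proof (intro AE_I2 impI)
          fix y assume y: "y \<in> space P" "y \<notin> {x}"
          have "cis (2 * pi * (y - x)) \<noteq> 1"
          proof
            assume "cis (2 * pi * (y - x)) = 1"
            then obtain n :: int where "2 * pi * (y - x) = of_int n * (2 * pi)"
              unfolding cis_eq_1_iff by blast
            then have n: "y - x = of_int n" by simp
            \<comment> \<open>On the half-open \<open>{0..<1}\<close> two points cannot differ by a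
              nonzero integer.\<close>
            moreover have "\<bar>y - x\<bar> < 1" using subsetD[OF circle x] subsetD[OF circle y(1)] by auto
            ultimately have "\<bar>real_of_int n\<bar> < 1" by simp
            then have "n = 0" by linarith
            then show False using n y by simp
          qed
          then show "(\<lambda>N. D N x y) \<longlonglongrightarrow> complex_of_real (indicator {x} y)"
            using y cis_average_tendsto_0[of _ k] unfolding D_def by simp
        qed
      qed
      show "(\<lambda>y. complex_of_real (indicator {x} y)) \<in> borel_measurable P" using atomless[OF x] by auto
    qed (auto simp: D_le D_meas)
    then show ?thesis using atomless[OF x] by simp
  qed
  have "(\<lambda>N. \<integral>x. I N x \<partial>P) \<longlonglongrightarrow> (\<integral>x. 0 \<partial>P)"
  proof (rule integral_dominated_convergence[where w = "\<lambda>_. measure P (space P)"])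
    show "AE x in P. norm (I N x) \<le> measure P (space P)" for N
    proof (rule AE_I2)
      fix x
      have "norm (I N x) \<le> (\<integral>y. norm (D N x y) \<partial>P)"
        unfolding I_def by (rule integral_norm_bound)
      also have "\<dots> \<le> (\<integral>y. 1 \<partial>P)"
        by (intro integral_mono integrable_const_bound[where B = 1]) (auto simp: D_le D_meas)
      finally show "norm (I N x) \<le> measure P (space P)" by simp
    qed
    show "(\<lambda>x. I N x) \<in> borel_measurable P" for N
      unfolding I_eq by measurable
  qed (auto simp: I_lim)
  moreover have "(\<integral>x. I N x \<partial>P) = of_real ((\<Sum>j<N. (norm (ft P (m j)))\<^sup>2) / real N)" for N
  proof -
    have "(\<integral>x. I N x \<partial>P) = (\<Sum>j<N. ft P (m j) * cnj (ft P (m j))) / of_nat N"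
    proof -
      have "integrable P (\<lambda>x. cis (- (2 * pi * m j * x)))" for j
        using integrable_cis[of "- (2 * pi * m j)"] by simp
      then show ?thesis unfolding I_eq by (simp add: ft_def)
    qed
    also have "\<dots> = of_real ((\<Sum>j<N. (norm (ft P (m j)))\<^sup>2) / real N)"
      by (simp flip: complex_norm_square)
    finally show ?thesis .
  qed
  ultimately have "(\<lambda>N. complex_of_real ((\<Sum>j<N. (norm (ft P (m j)))\<^sup>2) / real N)) \<longlonglongrightarrow> of_real 0"
    by simp
  then show ?thesis unfolding m_def by (simp only: tendsto_of_real_iff)
qed

text \<open>Absolute values rather than squares are what the triangle inequality for
  \<open>W\<close> produces.\<close>

lemma wiener_mean:
  assumes "space P \<subseteq> {0..<1}" "\<And>x. x \<in> space P \<Longrightarrow> {x} \<in> sets P \<and> measure P {x} = 0"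
  shows "(\<lambda>N. (\<Sum>j<N. norm (ft P (of_int (int j - k)))) / real N) \<longlonglongrightarrow> 0"
proof (rule Lim_null_comparison)
  show "(\<lambda>N. sqrt ((\<Sum>j<N. (norm (ft P (of_int (int j - k))))\<^sup>2) / real N)) \<longlonglongrightarrow> 0"
    using tendsto_real_sqrt[OF wiener_mean_square[OF assms, of k]] by simp
  show "\<forall>\<^sub>F N in sequentially. norm ((\<Sum>j<N. norm (ft P (of_int (int j - k)))) / real N)
      \<le> sqrt ((\<Sum>j<N. (norm (ft P (of_int (int j - k))))\<^sup>2) / real N)"
    using average_le_sqrt_average by (intro always_eventually allI) (simp add: sum_nonneg)
qed

end

section \<open>Point masses of a measure on the line\<close>

text \<open>The uniform distribution on \<open>{0..<T}\<close>. The interval is half-open so that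
  for integral \<open>T\<close> it is tiled by the unit cells on which the floor is
  constant.\<close>

definition unif :: "real \<Rightarrow> real measure" where
  "unif T = density lborel (\<lambda>\<xi>. indicator {0..<T} \<xi> / T)"

lemma sets_unif [simp, measurable_cong]: "sets (unif T) = sets borel"
  by (simp add: unif_def)

lemma space_unif [simp]: "space (unif T) = UNIV"
  by (simp add: unif_def)

text \<open>The closed interval on the right, which differs by a null point, is the form used by the
  fundamental theorem of calculus.\<close>

lemma integral_unif:
  fixes f :: "real \<Rightarrow> complex"
  assumes [measurable]: "f \<in> borel_measurable borel" and T: "T > 0"
  shows "(\<integral>\<xi>. f \<xi> \<partial>unif T) = (1 / T) *\<^sub>R (\<integral>\<xi>. indicator {0..T} \<xi> *\<^sub>R f \<xi> \<partial>lborel)"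
proof -
  have "(\<integral>\<xi>. f \<xi> \<partial>unif T) = (\<integral>\<xi>. (indicator {0..<T} \<xi> / T) *\<^sub>R f \<xi> \<partial>lborel)"
    unfolding unif_def using T by (intro integral_density) auto
  also have "\<dots> = (\<integral>\<xi>. (1 / T) *\<^sub>R (indicator {0..T} \<xi> *\<^sub>R f \<xi>) \<partial>lborel)"
  proof (rule integral_cong_AE)
    show "AE \<xi> in lborel. (indicator {0..<T} \<xi> / T) *\<^sub>R f \<xi> = (1 / T) *\<^sub>R (indicator {0..T} \<xi> *\<^sub>R f \<xi>)"
      using AE_lborel_singleton[of T] by eventually_elim (auto simp: indicator_def)
  qed auto
  also have "\<dots> = (1 / T) *\<^sub>R (\<integral>\<xi>. indicator {0..T} \<xi> *\<^sub>R f \<xi> \<partial>lborel)"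
    by (rule Bochner_Integration.integral_scaleR_right)
  finally show ?thesis .
qed

lemma nn_integral_unif:
  assumes [measurable]: "f \<in> borel_measurable borel"
  shows "(\<integral>\<^sup>+\<xi>. f \<xi> \<partial>unif T) = (\<integral>\<^sup>+\<xi>. ennreal (indicator {0..<T} \<xi> / T) * f \<xi> \<partial>lborel)"
  unfolding unif_def by (rule nn_integral_density) auto

lemma prob_space_unif:
  assumes "T > 0"
  shows "prob_space (unif T)"
proof
  have "emeasure (unif T) (space (unif T)) = (\<integral>\<^sup>+\<xi>. ennreal (1 / T) * indicator {0..<T} \<xi> \<partial>lborel)"
    unfolding unif_def using assms
    by (subst emeasure_density) (auto intro!: nn_integral_cong simp: indicator_def)
  also have "\<dots> = ennreal (1 / T) * ennreal T"
    using assms by (subst nn_integral_cmult_indicator) auto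
  also have "\<dots> = 1" using assms by (simp flip: ennreal_mult)
  finally show "emeasure (unif T) (space (unif T)) = 1" .
qed

lemma AE_unif:
  assumes "AE \<xi> in lborel. Q \<xi>"
  shows "AE \<xi> in unif T. Q \<xi>"
  unfolding unif_def using assms by (subst AE_density) auto

text \<open>The primitive \<open>cis (t * \<xi>) / (\<i> * t)\<close> has modulus
  \<open>1 / \<bar>t\<bar>\<close>, so the integral over any interval is at most
  \<open>2 / \<bar>t\<bar>\<close>, and averaging divides this by the length.\<close>

lemma cis_integral_unif_tendsto_0:
  assumes "t \<noteq> 0"
  shows "(\<lambda>N. \<integral>\<xi>. cis (t * \<xi>) \<partial>unif (real (Suc N))) \<longlonglongrightarrow> 0"
proof (rule Lim_null_comparison)
  have bound: "norm (\<integral>\<xi>. cis (t * \<xi>) \<partial>unif T) \<le> (2 / \<bar>t\<bar>) / T" if T: "T > 0" for T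
  proof -
    have deriv: "((\<lambda>\<xi>. cis (t * \<xi>) / (\<i> * t)) has_vector_derivative cis (t * \<xi>)) (at \<xi> within S)" for \<xi> S
      unfolding cis_conv_exp using assms
      by (auto intro!: derivative_eq_intros has_vector_derivative_real_field simp: algebra_simps)
    have "(\<integral>\<xi>. indicator {0..T} \<xi> *\<^sub>R cis (t * \<xi>) \<partial>lborel) = cis (t * T) / (\<i> * t) - cis (t * 0) / (\<i> * t)"
      using T by (intro integral_FTC_atLeastAtMost deriv continuous_intros) auto
    also have "\<dots> = (cis (t * T) - 1) / (\<i> * t)" by (simp add: diff_divide_distrib)
    also have "norm \<dots> \<le> 2 / \<bar>t\<bar>"
      using norm_triangle_ineq4[of "cis (t * T)" 1]
      by (simp add: norm_divide norm_mult divide_right_mono)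
    finally have "norm (\<integral>\<xi>. indicator {0..T} \<xi> *\<^sub>R cis (t * \<xi>) \<partial>lborel) \<le> 2 / \<bar>t\<bar>" .
    then show ?thesis
      using T by (subst integral_unif) (auto dest: divide_right_mono[where c = T])
  qed
  show "\<forall>\<^sub>F N in sequentially. norm (\<integral>\<xi>. cis (t * \<xi>) \<partial>unif (real (Suc N))) \<le> (2 / \<bar>t\<bar>) / real (Suc N)"
    by (intro always_eventually allI bound) simp
  show "(\<lambda>N. (2 / \<bar>t\<bar>) / real (Suc N)) \<longlonglongrightarrow> 0"
    by (rule LIMSEQ_Suc[OF lim_const_over_n])
qed

text \<open>By Fubini the average is the \<open>P\<close>-integral of averaged characters of
  frequency \<open>x - y\<close>. These are bounded by 1 and converge to the indicator of
  \<open>y = x\<close>. Lengths \<open>Suc N\<close> keep \<open>unif\<close> a probability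
  measure.\<close>

lemma point_mass_limit:
  assumes fin: "finite_measure P" and sets [measurable_cong]: "sets P = sets borel"
  shows "(\<lambda>N. \<integral>\<xi>. cis (2 * pi * x * \<xi>) * ft P \<xi> \<partial>unif (real (Suc N))) \<longlonglongrightarrow> measure P {x}"
proof -
  interpret P: finite_measure P by (rule fin)
  define K where "K N y = (\<integral>\<xi>. cis (2 * pi * (x - y) * \<xi>) \<partial>unif (real (Suc N)))" for N y
  have "(\<lambda>N. \<integral>y. K N y \<partial>P) \<longlonglongrightarrow> (\<integral>y. complex_of_real (indicator {x} y) \<partial>P)"
  proof (rule integral_dominated_convergence[where w = "\<lambda>_. 1"])
    show "K N \<in> borel_measurable P" for N
    proof -
      interpret Q: prob_space "unif (real (Suc N))" by (rule prob_space_unif) simp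
      show ?thesis unfolding K_def by measurable
    qed
    show "AE y in P. (\<lambda>N. K N y) \<longlonglongrightarrow> complex_of_real (indicator {x} y)"
    proof (rule AE_I2)
      fix y
      show "(\<lambda>N. K N y) \<longlonglongrightarrow> complex_of_real (indicator {x} y)"
      proof (cases "y = x")
        case True
        have "K N y = 1" for N
        proof -
          interpret Q: prob_space "unif (real (Suc N))" by (rule prob_space_unif) simp
          show ?thesis using True Q.prob_space by (simp add: K_def)
        qed
        then show ?thesis using True by simp
      next
        case False
        then show ?thesis
          using cis_integral_unif_tendsto_0[of "2 * pi * (x - y)"] by (simp add: K_def)
      qed
    qed
    show "AE y in P. norm (K N y) \<le> 1" for N
    proof (rule AE_I2)
      fix y
      interpret Q: prob_space "unif (real (Suc N))" by (rule prob_space_unif) simp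
      have "norm (K N y) \<le> (\<integral>\<xi>. norm (cis (2 * pi * (x - y) * \<xi>)) \<partial>unif (real (Suc N)))"
        unfolding K_def by (rule integral_norm_bound)
      then show "norm (K N y) \<le> 1" using Q.prob_space by simp
    qed
  qed auto
  moreover have "(\<integral>y. K N y \<partial>P) = (\<integral>\<xi>. cis (2 * pi * x * \<xi>) * ft P \<xi> \<partial>unif (real (Suc N)))" for N
  proof -
    interpret Q: prob_space "unif (real (Suc N))" by (rule prob_space_unif) simp
    interpret PQ: pair_sigma_finite "unif (real (Suc N))" P ..
    interpret F: finite_measure "unif (real (Suc N)) \<Otimes>\<^sub>M P"
      by (rule finite_measure_pair_measure) unfold_locales
    have "(\<integral>y. K N y \<partial>P) = (\<integral>\<xi>. \<integral>y. cis (2 * pi * (x - y) * \<xi>) \<partial>P \<partial>unif (real (Suc N)))"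
      unfolding K_def
      by (rule PQ.Fubini_integral) (rule F.integrable_const_bound[where B = 1]; simp add: split_beta)
    also have "\<dots> = (\<integral>\<xi>. cis (2 * pi * x * \<xi>) * ft P \<xi> \<partial>unif (real (Suc N)))"
      by (simp add: ft_def cis_mult algebra_simps flip: integral_mult_right_zero)
    finally show ?thesis .
  qed
  ultimately show ?thesis using sets by (simp add: sets_eq_imp_space_eq)
qed

section \<open>Periodized majorants\<close>

text \<open>The right side is an integral over counting measure so that Tonelli applies later. For a
  family that is not summable, \<open>infsum\<close> has the default value 0 and the bound is
  trivial.\<close>

lemma ennreal_norm_infsum_le:
  fixes f :: "'a \<Rightarrow> complex"
  shows "ennreal (norm (infsum f A)) \<le> (\<integral>\<^sup>+n. ennreal (norm (f n)) \<partial>count_space A)"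
proof (cases "f summable_on A")
  case True
  then have "Infinite_Set_Sum.abs_summable_on f A"
    by (simp add: summable_on_iff_abs_summable_on_complex abs_summable_equivalent)
  then show ?thesis
    using integral_norm_bound_ennreal[of "count_space A" f]
    by (simp add: infsetsum_infsum[symmetric] infsetsum_def Infinite_Set_Sum.abs_summable_on_def)
qed (simp add: infsum_not_exists)

text \<open>After exchanging sum and integral and translating, the integral over \<open>{0..<N}\<close> becomes
  \<open>\<integral> g(y) \<Sum>j<N. a(j - \<lfloor>y\<rfloor>) dy\<close>, because \<open>0 \<le> y + n < N\<close> means \<open>n = j - \<lfloor>y\<rfloor>\<close> with \<open>0 \<le> j < N\<close>.\<close>

lemma nn_integral_unif_periodization:
  fixes a :: "int \<Rightarrow> ennreal" and g :: "real \<Rightarrow> ennreal"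
  assumes g [measurable]: "g \<in> borel_measurable borel" and N: "N > 0"
  shows "(\<integral>\<^sup>+\<xi>. (\<integral>\<^sup>+n. a n * g (\<xi> - of_int n) \<partial>count_space UNIV) \<partial>unif (real N)) =
    (\<integral>\<^sup>+y. g y * (ennreal (1 / real N) * (\<Sum>j<N. a (int j - \<lfloor>y\<rfloor>))) \<partial>lborel)"
proof -
  define w where "w \<xi> = ennreal (indicator {0..<real N} \<xi> / real N)" for \<xi>
  have [measurable]: "w \<in> borel_measurable borel" unfolding w_def by measurable
  have meas: "(\<lambda>\<xi>. \<integral>\<^sup>+n. a n * g (\<xi> - of_int n) \<partial>count_space UNIV) \<in> borel_measurable borel"
  proof (rule sigma_finite_measure.borel_measurable_nn_integral[OF sigma_finite_measure_count_space])
    show "(\<lambda>(\<xi>, n). a n * g (\<xi> - of_int n)) \<in> borel_measurable (borel \<Otimes>\<^sub>M count_space UNIV)"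
      unfolding split_beta
      by (rule measurable_compose_countable[where g = snd and f = "\<lambda>n p. a n * g (fst p - of_int n)"]) measurable
  qed
  have sum: "(\<integral>\<^sup>+n. w (y + of_int n) * a n \<partial>count_space UNIV) =
      ennreal (1 / real N) * (\<Sum>j<N. a (int j - \<lfloor>y\<rfloor>))" for y
  proof -
    define S where "S = (\<lambda>j. int j - \<lfloor>y\<rfloor>) ` {..<N}"
    have S_iff: "n \<in> S \<longleftrightarrow> y + of_int n \<in> {0..<real N}" for n
    proof -
      have "n \<in> S \<longleftrightarrow> 0 \<le> n + \<lfloor>y\<rfloor> \<and> n + \<lfloor>y\<rfloor> < int N"
        unfolding S_def by (auto intro!: image_eqI[of _ _ "nat (n + \<lfloor>y\<rfloor>)"])
      also have "n + \<lfloor>y\<rfloor> = \<lfloor>y + of_int n\<rfloor>" by simp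
      also have "0 \<le> \<lfloor>y + of_int n\<rfloor> \<and> \<lfloor>y + of_int n\<rfloor> < int N \<longleftrightarrow> y + of_int n \<in> {0..<real N}"
        by (simp only: zero_le_floor floor_less_iff atLeastLessThan_iff of_int_of_nat_eq)
      finally show ?thesis .
    qed
    \<comment> \<open>Off the finite set \<open>S\<close> the weight vanishes, and on
      \<open>S\<close> it is the constant \<open>1 / N\<close>.\<close>
    have "(\<integral>\<^sup>+n. w (y + of_int n) * a n \<partial>count_space UNIV) = (\<Sum>n\<in>S. w (y + of_int n) * a n)"
      using S_iff by (intro nn_integral_count_space') (auto simp: S_def w_def indicator_def)
    also have "\<dots> = (\<Sum>n\<in>S. ennreal (1 / real N) * a n)"
      using S_iff by (intro sum.cong) (auto simp: w_def indicator_def)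
    also have "\<dots> = ennreal (1 / real N) * (\<Sum>j<N. a (int j - \<lfloor>y\<rfloor>))"
      unfolding S_def by (subst sum.reindex) (auto simp: inj_on_def sum_distrib_left)
    finally show ?thesis .
  qed
  have "(\<integral>\<^sup>+\<xi>. (\<integral>\<^sup>+n. a n * g (\<xi> - of_int n) \<partial>count_space UNIV) \<partial>unif (real N)) =
      (\<integral>\<^sup>+\<xi>. (\<integral>\<^sup>+n. w \<xi> * (a n * g (\<xi> - of_int n)) \<partial>count_space UNIV) \<partial>lborel)"
    using meas by (simp add: nn_integral_unif w_def nn_integral_cmult)
  also have "\<dots> = (\<integral>\<^sup>+n. (\<integral>\<^sup>+\<xi>. w \<xi> * (a n * g (\<xi> - of_int n)) \<partial>lborel) \<partial>count_space UNIV)"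
    by (rule nn_integral_count_space_nn_integral) auto
  also have "\<dots> = (\<integral>\<^sup>+n. (\<integral>\<^sup>+y. g y * (w (y + of_int n) * a n) \<partial>lborel) \<partial>count_space UNIV)"
  proof (rule nn_integral_cong)
    fix n :: int
    \<comment> \<open>Translation by \<open>n\<close> moves the shift from \<open>g\<close> to the
      window \<open>w\<close>; the factor \<open>1 * y\<close> only matches the affine substitution
      rule.\<close>
    have "(\<integral>\<^sup>+\<xi>. w \<xi> * (a n * g (\<xi> - of_int n)) \<partial>lborel) =
        (\<integral>\<^sup>+y. w (of_int n + 1 * y) * (a n * g (of_int n + 1 * y - of_int n)) \<partial>lborel)"
      by (subst nn_integral_real_affine[where c = 1 and t = "of_int n"]) simp_all
    then show "(\<integral>\<^sup>+\<xi>. w \<xi> * (a n * g (\<xi> - of_int n)) \<partial>lborel) =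
        (\<integral>\<^sup>+y. g y * (w (y + of_int n) * a n) \<partial>lborel)"
      by (simp add: ac_simps)
  qed
  also have "\<dots> = (\<integral>\<^sup>+y. (\<integral>\<^sup>+n. g y * (w (y + of_int n) * a n) \<partial>count_space UNIV) \<partial>lborel)"
    by (rule nn_integral_count_space_nn_integral[symmetric]) auto
  also have "\<dots> = (\<integral>\<^sup>+y. g y * (ennreal (1 / real N) * (\<Sum>j<N. a (int j - \<lfloor>y\<rfloor>))) \<partial>lborel)"
    by (simp add: nn_integral_cmult sum)
  finally show ?thesis .
qed

text \<open>Dominated convergence with dominating function \<open>g y * C\<close>: for fixed
  \<open>y\<close> the means tend to 0, by the hypothesis for
  \<open>k = \<lfloor>y\<rfloor>\<close>.\<close>

lemma periodization_tendsto_0: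
  fixes a :: "int \<Rightarrow> real" and g :: "real \<Rightarrow> ennreal"
  assumes g [measurable]: "g \<in> borel_measurable borel" and g_fin: "(\<integral>\<^sup>+y. g y \<partial>lborel) < \<infinity>"
    and a: "\<And>n. 0 \<le> a n" "\<And>n. a n \<le> C"
    and mean: "\<And>k. (\<lambda>N. (\<Sum>j<N. a (int j - k)) / real N) \<longlonglongrightarrow> 0"
  shows "(\<lambda>N. \<integral>\<^sup>+\<xi>. (\<integral>\<^sup>+n. ennreal (a n) * g (\<xi> - of_int n) \<partial>count_space UNIV) \<partial>unif (real (Suc N))) \<longlonglongrightarrow> 0"
proof -
  define A where "A N y = ennreal ((\<Sum>j<Suc N. a (int j - \<lfloor>y\<rfloor>)) / real (Suc N))" for N and y :: real
  have A_eq: "ennreal (1 / real (Suc N)) * (\<Sum>j<Suc N. ennreal (a (int j - \<lfloor>y\<rfloor>))) = A N y" for N and y :: real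
  proof -
    have "(\<Sum>j<Suc N. ennreal (a (int j - \<lfloor>y\<rfloor>))) = ennreal (\<Sum>j<Suc N. a (int j - \<lfloor>y\<rfloor>))"
      using a by (intro sum_ennreal) auto
    moreover have "0 \<le> (\<Sum>j<Suc N. a (int j - \<lfloor>y\<rfloor>))" using a by (intro sum_nonneg) auto
    ultimately show ?thesis
      unfolding A_def by (simp flip: ennreal_mult del: sum.lessThan_Suc of_nat_Suc)
  qed
  have A_le: "A N y \<le> ennreal C" for N y
  proof -
    have "(\<Sum>j<Suc N. a (int j - \<lfloor>y\<rfloor>)) \<le> real (Suc N) * C"
      using sum_bounded_above[of "{..<Suc N}" "\<lambda>j. a (int j - \<lfloor>y\<rfloor>)" C] a by simp
    then show ?thesis unfolding A_def by (intro ennreal_leI) (simp add: divide_le_eq mult.commute)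
  qed
  have [measurable]: "A N \<in> borel_measurable borel" for N
  proof -
    have "(\<lambda>k::int. ennreal ((\<Sum>j<Suc N. a (int j - k)) / real (Suc N))) \<in> borel_measurable (count_space UNIV)"
      by simp
    from measurable_compose[OF measurable_real_floor this] show ?thesis
      unfolding A_def[abs_def] by simp
  qed
  \<comment> \<open>Multiplication on \<open>ennreal\<close> is not continuous at infinity times 0,
    so the points with infinite \<open>g\<close> are discarded.\<close>
  have g_top: "AE y in lborel. g y \<noteq> \<infinity>"
    using g_fin by (intro nn_integral_noteq_infinite) auto
  have "(\<lambda>N. \<integral>\<^sup>+y. g y * A N y \<partial>lborel) \<longlonglongrightarrow> (\<integral>\<^sup>+(y::real). 0 \<partial>lborel)"
  proof (rule nn_integral_dominated_convergence[where w = "\<lambda>y. g y * ennreal C"])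
    show "AE y in lborel. (\<lambda>N. g y * A N y) \<longlonglongrightarrow> 0"
      using g_top
    proof eventually_elim
      case (elim y)
      have "(\<lambda>N. A N y) \<longlonglongrightarrow> ennreal 0"
        unfolding A_def by (intro tendsto_ennrealI LIMSEQ_Suc[OF mean])
      then have "(\<lambda>N. g y * A N y) \<longlonglongrightarrow> g y * 0"
        using elim by (intro tendsto_mult_ennreal tendsto_const) auto
      then show ?case by simp
    qed
    show "(\<integral>\<^sup>+y. g y * ennreal C \<partial>lborel) < \<infinity>"
      using g_fin by (simp add: nn_integral_multc ennreal_mult_less_top)
  qed (auto intro!: mult_left_mono A_le)
  then show ?thesis
    by (simp only: nn_integral_unif_periodization[OF g zero_less_Suc] A_eq nn_integral_const mult_zero_left)
qed

section \<open>Complex measures\<close>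

text \<open>Interface to the four Jordan parts: what follows deals with finite positive measures and
  linear combinations of them.\<close>

lemma complex_measure_jordan:
  assumes "complex_measure M \<mu>"
  obtains P1 P2 P3 P4 where
    "\<And>P. P \<in> {P1, P2, P3, P4} \<Longrightarrow> finite_measure P \<and> sets P = sets M"
    "\<And>A. A \<in> sets M \<Longrightarrow> \<mu> A = (of_real (measure P1 A) - of_real (measure P2 A)) +
       \<i> * (of_real (measure P3 A) - of_real (measure P4 A))"
    "\<And>x P. {x} \<in> sets M \<Longrightarrow> \<mu> {x} = 0 \<Longrightarrow> P \<in> {P1, P2, P3, P4} \<Longrightarrow> measure P {x} = 0"
    "\<And>f. complex_measure_integral M \<mu> f =
       ((\<integral>x. f x \<partial>P1) - (\<integral>x. f x \<partial>P2)) + \<i> * ((\<integral>x. f x \<partial>P3) - (\<integral>x. f x \<partial>P4))"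
proof
  interpret re: signed_measure M "\<lambda>A. Re (\<mu> A)" using assms by (rule complex_measure_signed)
  interpret im: signed_measure M "\<lambda>A. Im (\<mu> A)" using assms by (rule complex_measure_signed)
  interpret nre: signed_measure M "\<lambda>A. - Re (\<mu> A)" by (rule re.uminus)
  interpret nim: signed_measure M "\<lambda>A. - Im (\<mu> A)" by (rule im.uminus)
  let ?P = "{jordan_pos M (\<lambda>A. Re (\<mu> A)), jordan_pos M (\<lambda>A. - Re (\<mu> A)),
    jordan_pos M (\<lambda>A. Im (\<mu> A)), jordan_pos M (\<lambda>A. - Im (\<mu> A))}"
  show "finite_measure P \<and> sets P = sets M" if "P \<in> ?P" for P
    using that re.finite_measure_jordan_pos nre.finite_measure_jordan_pos
      im.finite_measure_jordan_pos nim.finite_measure_jordan_pos by auto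
  show "measure P {x} = 0" if "{x} \<in> sets M" "\<mu> {x} = 0" "P \<in> ?P" for x P
    using that by (auto simp: re.measure_jordan_pos_singleton nre.measure_jordan_pos_singleton
      im.measure_jordan_pos_singleton nim.measure_jordan_pos_singleton)
  show "\<mu> A = (of_real (measure (jordan_pos M (\<lambda>A. Re (\<mu> A))) A) - of_real (measure (jordan_pos M (\<lambda>A. - Re (\<mu> A))) A)) +
      \<i> * (of_real (measure (jordan_pos M (\<lambda>A. Im (\<mu> A))) A) - of_real (measure (jordan_pos M (\<lambda>A. - Im (\<mu> A))) A))"
    if "A \<in> sets M" for A
    using re.jordan_decomposition[OF that] im.jordan_decomposition[OF that]
    by (simp add: complex_eq_iff)
qed (simp add: complex_measure_integral_def)

lemma norm_cartesian_le:
  fixes a b c d :: complex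
  shows "norm ((a - b) + \<i> * (c - d)) \<le> (norm a + norm b) + (norm c + norm d)"
  by (intro norm_triangle_mono norm_triangle_le_diff) (auto simp: norm_mult norm_triangle_ineq4)

text \<open>Each Jordan part of \<open>\<nu>\<close> is atomless, so Wiener's lemma applies to all
  four. \<open>C\<close> is the sum of their total masses.\<close>

lemma fourier_measure_T_mean_tendsto_0:
  assumes \<nu>: "\<nu> \<in> measures_T" "continuous_measure circle_borel \<nu>"
  obtains C where "\<And>n. norm (fourier_measure_T \<nu> n) \<le> C"
    "\<And>k. (\<lambda>N. (\<Sum>j<N. norm (fourier_measure_T \<nu> (int j - k))) / real N) \<longlonglongrightarrow> 0"
proof -
  have "complex_measure circle_borel \<nu>" using \<nu> by (simp add: measures_T_def)
  then obtain P1 P2 P3 P4 where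
    P: "\<And>P. P \<in> {P1, P2, P3, P4} \<Longrightarrow> finite_measure P \<and> sets P = sets circle_borel" and
    zero: "\<And>x P. {x} \<in> sets circle_borel \<Longrightarrow> \<nu> {x} = 0 \<Longrightarrow> P \<in> {P1, P2, P3, P4} \<Longrightarrow> measure P {x} = 0" and
    int: "\<And>f. complex_measure_integral circle_borel \<nu> f =
       ((\<integral>x. f x \<partial>P1) - (\<integral>x. f x \<partial>P2)) + \<i> * ((\<integral>x. f x \<partial>P3) - (\<integral>x. f x \<partial>P4))"
    by (rule complex_measure_jordan) blast
  have ident: "(\<lambda>x. x) \<in> borel_measurable P" if "P \<in> {P1, P2, P3, P4}" for P
    using P[OF that] by (simp add: measurable_restrict_space1 cong: measurable_cong_sets)
  have space: "space P = {0..<1}" if "P \<in> {P1, P2, P3, P4}" for P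
    using P[OF that] by (simp add: space_restrict_space sets_eq_imp_space_eq[of P circle_borel])
  have sing: "{x} \<in> sets circle_borel" if "x \<in> {0..<1}" for x :: real
    using that by (simp add: sets_restrict_space_iff)
  have mean: "(\<lambda>N. (\<Sum>j<N. norm (ft P (of_int (int j - k)))) / real N) \<longlonglongrightarrow> 0" if "P \<in> {P1, P2, P3, P4}" for P k
    using that \<nu>(2) P[OF that] ident[OF that] space[OF that] sing zero[OF _ _ that]
    by (intro wiener_mean) (auto simp: continuous_measure_def space_restrict_space)
  have le: "norm (fourier_measure_T \<nu> n) \<le> (norm (ft P1 (of_int n)) + norm (ft P2 (of_int n))) +
      (norm (ft P3 (of_int n)) + norm (ft P4 (of_int n)))" (is "_ \<le> ?b n") for n
    unfolding fourier_measure_T_def int ft_def by (rule norm_cartesian_le)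
  show ?thesis
  proof
    have "norm (ft P t) \<le> measure P (space P)" if "P \<in> {P1, P2, P3, P4}" for P t
      using P[OF that] ident[OF that] by (intro norm_ft_le) auto
    then have "?b n \<le> (measure P1 (space P1) + measure P2 (space P2)) + (measure P3 (space P3) + measure P4 (space P4))" for n
      by (intro add_mono) auto
    with le show "norm (fourier_measure_T \<nu> n)
        \<le> (measure P1 (space P1) + measure P2 (space P2)) + (measure P3 (space P3) + measure P4 (space P4))" for n
      by (rule order_trans)
    show "(\<lambda>N. (\<Sum>j<N. norm (fourier_measure_T \<nu> (int j - k))) / real N) \<longlonglongrightarrow> 0" for k
    proof (rule Lim_null_comparison)
      have "(\<lambda>N. ((\<Sum>j<N. norm (ft P1 (of_int (int j - k)))) / real N + (\<Sum>j<N. norm (ft P2 (of_int (int j - k)))) / real N) +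
          ((\<Sum>j<N. norm (ft P3 (of_int (int j - k)))) / real N + (\<Sum>j<N. norm (ft P4 (of_int (int j - k)))) / real N))
          \<longlonglongrightarrow> (0 + 0) + (0 + 0)"
        by (intro tendsto_add mean) auto
      then show "(\<lambda>N. (\<Sum>j<N. ?b (int j - k)) / real N) \<longlonglongrightarrow> 0"
        by (simp add: sum.distrib add_divide_distrib)
      show "\<forall>\<^sub>F N in sequentially. norm ((\<Sum>j<N. norm (fourier_measure_T \<nu> (int j - k))) / real N)
          \<le> (\<Sum>j<N. ?b (int j - k)) / real N"
        by (intro always_eventually allI)
           (auto simp: sum_nonneg abs_of_nonneg intro!: divide_right_mono sum_mono le[THEN order_trans])
    qed
  qed
qed

text \<open>Linear combination of \<open>point_mass_limit\<close> over the four parts. Integrability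
  is recorded for the later bound of the norm of the integral by the integral of the norm.\<close>

lemma fourier_measure_R_point_mass:
  assumes \<mu>: "\<mu> \<in> measures_R"
  shows "(\<lambda>N. \<integral>\<xi>. cis (2 * pi * x * \<xi>) * fourier_measure_R \<mu> \<xi> \<partial>unif (real (Suc N))) \<longlonglongrightarrow> \<mu> {x}"
    and "integrable (unif (real (Suc N))) (\<lambda>\<xi>. cis (2 * pi * x * \<xi>) * fourier_measure_R \<mu> \<xi>)"
proof -
  have "complex_measure borel \<mu>" using \<mu> by (simp add: measures_R_def)
  then obtain P1 P2 P3 P4 where
    P: "\<And>P. P \<in> {P1, P2, P3, P4} \<Longrightarrow> finite_measure P \<and> sets P = sets borel" and
    eq: "\<And>A. A \<in> sets borel \<Longrightarrow> \<mu> A = (of_real (measure P1 A) - of_real (measure P2 A)) +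
       \<i> * (of_real (measure P3 A) - of_real (measure P4 A))" and
    int: "\<And>f. complex_measure_integral borel \<mu> f =
       ((\<integral>x. f x \<partial>P1) - (\<integral>x. f x \<partial>P2)) + \<i> * ((\<integral>x. f x \<partial>P3) - (\<integral>x. f x \<partial>P4))"
    by (rule complex_measure_jordan) blast
  let ?f = "\<lambda>P \<xi>. cis (2 * pi * x * \<xi>) * ft P \<xi>"
  have integrable: "integrable (unif (real (Suc N))) (?f P)" if "P \<in> {P1, P2, P3, P4}" for P N
  proof -
    interpret finite_measure P using P[OF that] by simp
    have [measurable_cong]: "sets P = sets borel" using P[OF that] by simp
    interpret Q: prob_space "unif (real (Suc N))" by (rule prob_space_unif) simp
    have [measurable]: "ft P \<in> borel_measurable borel"
      unfolding ft_def[abs_def] by measurable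
    have "norm (ft P \<xi>) \<le> measure P (space P)" for \<xi>
      by (rule norm_ft_le) (unfold_locales, measurable)
    then show ?thesis
      by (intro Q.integrable_const_bound[where B = "measure P (space P)"]) (auto simp: norm_mult)
  qed
  have split: "cis (2 * pi * x * \<xi>) * fourier_measure_R \<mu> \<xi> =
      (?f P1 \<xi> - ?f P2 \<xi>) + \<i> * (?f P3 \<xi> - ?f P4 \<xi>)" for \<xi>
    unfolding fourier_measure_R_def int ft_def by (simp add: algebra_simps)
  show "integrable (unif (real (Suc N))) (\<lambda>\<xi>. cis (2 * pi * x * \<xi>) * fourier_measure_R \<mu> \<xi>)" for N
    unfolding split by (intro Bochner_Integration.integrable_add Bochner_Integration.integrable_diff
      integrable_mult_right integrable) auto
  have "(\<integral>\<xi>. cis (2 * pi * x * \<xi>) * fourier_measure_R \<mu> \<xi> \<partial>unif (real (Suc N))) =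
      ((\<integral>\<xi>. ?f P1 \<xi> \<partial>unif (real (Suc N))) - (\<integral>\<xi>. ?f P2 \<xi> \<partial>unif (real (Suc N)))) +
      \<i> * ((\<integral>\<xi>. ?f P3 \<xi> \<partial>unif (real (Suc N))) - (\<integral>\<xi>. ?f P4 \<xi> \<partial>unif (real (Suc N))))" for N
    unfolding split using integrable by (simp del: of_nat_Suc)
  moreover have "(\<lambda>N. ((\<integral>\<xi>. ?f P1 \<xi> \<partial>unif (real (Suc N))) - (\<integral>\<xi>. ?f P2 \<xi> \<partial>unif (real (Suc N)))) +
      \<i> * ((\<integral>\<xi>. ?f P3 \<xi> \<partial>unif (real (Suc N))) - (\<integral>\<xi>. ?f P4 \<xi> \<partial>unif (real (Suc N))))) \<longlonglongrightarrow> \<mu> {x}"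
    unfolding eq[OF borel_singleton[OF sets.empty_sets]]
    using P by (intro tendsto_intros point_mass_limit) auto
  ultimately show "(\<lambda>N. \<integral>\<xi>. cis (2 * pi * x * \<xi>) * fourier_measure_R \<mu> \<xi> \<partial>unif (real (Suc N))) \<longlonglongrightarrow> \<mu> {x}"
    by simp
qed

section \<open>The transferred measure\<close>

lemma AE_lborel_translate:
  assumes "AE x in lborel. Q x"
  shows "AE x in lborel. Q (x - c :: real)"
proof -
  \<comment> \<open>The exceptional set is enlarged to a Borel null set because the affine rule asks
    for a measurable predicate.\<close>
  obtain N where N: "{x \<in> space lborel. \<not> Q x} \<subseteq> N" "emeasure lborel N = 0" "N \<in> sets lborel"
    using assms by (rule AE_E)
  have "AE x in lborel. x \<notin> N"
    using N by (intro AE_not_in) (auto simp: null_sets_def)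
  then have "AE x in lborel. - c + 1 * x \<notin> N"
    using N(3) by (intro AE_borel_affine) auto
  then show ?thesis
    by eventually_elim (use N(1) in auto)
qed

text \<open>Only countably many translates occur, so their exceptional sets have a null union and
  the triangle inequality holds off it.\<close>

lemma norm_W_le:
  assumes "AE \<xi> in lborel. ennreal (norm (\<Lambda> \<xi>)) = g \<xi>"
  shows "AE \<xi> in lborel. ennreal (norm (W \<phi> \<Lambda> \<xi>)) \<le> (\<integral>\<^sup>+n. ennreal (norm (\<phi> n)) * g (\<xi> - of_int n) \<partial>count_space UNIV)"
proof -
  have "AE \<xi> in lborel. \<forall>n::int. ennreal (norm (\<Lambda> (\<xi> - of_int n))) = g (\<xi> - of_int n)"
    unfolding AE_all_countable using AE_lborel_translate[OF assms] by blast
  then show ?thesis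
  proof eventually_elim
    case (elim \<xi>)
    show ?case
      unfolding W_def using ennreal_norm_infsum_le[of "\<lambda>n. \<phi> n * \<Lambda> (\<xi> - of_int n)" UNIV] elim
      by (simp add: norm_mult ennreal_mult)
  qed
qed

theorem theorem3p3:
  fixes \<Lambda> :: "real \<Rightarrow> complex" and \<Lambda>1 :: "real \<Rightarrow> real"
    and \<nu> \<mu> :: "real set \<Rightarrow> complex"
  assumes "\<Lambda> \<in> F0"
    and "decreasing_radial_L1_majorant \<Lambda> \<Lambda>1"
    and "\<nu> \<in> measures_T"
    and "\<mu> \<in> measures_R"
    and "AE \<xi> in lebesgue. fourier_measure_R \<mu> \<xi> = W (fourier_measure_T \<nu>) \<Lambda> \<xi>"
    and "continuous_measure circle_borel \<nu>"
  shows "continuous_measure borel \<mu>"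
proof -
  have \<Lambda>_meas: "\<Lambda> \<in> borel_measurable lebesgue"
    using assms(1) by (simp add: F0_def S10_def L_infinity_def)
  obtain C where C: "\<And>n. norm (fourier_measure_T \<nu> n) \<le> C"
    and mean: "\<And>k. (\<lambda>N. (\<Sum>j<N. norm (fourier_measure_T \<nu> (int j - k))) / real N) \<longlonglongrightarrow> 0"
    using fourier_measure_T_mean_tendsto_0[OF assms(3,6)] by blast
  have "(\<lambda>\<xi>. ennreal (norm (\<Lambda> \<xi>))) \<in> borel_measurable lebesgue"
    using \<Lambda>_meas by measurable
  \<comment> \<open>\<open>\<Lambda>\<close> is only Lebesgue measurable; a Borel version of its
    modulus makes the translates measurable for \<open>lborel\<close> and
    \<open>unif\<close>.\<close>
  then obtain g where g [measurable]: "g \<in> borel_measurable borel" and g_eq: "AE \<xi> in lborel. ennreal (norm (\<Lambda> \<xi>)) = g \<xi>"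
    using completion_ex_borel_measurable[of "\<lambda>\<xi>. ennreal (norm (\<Lambda> \<xi>))" lborel] by auto
  have "(\<integral>\<^sup>+\<xi>. g \<xi> \<partial>lborel) = (\<integral>\<^sup>+\<xi>. ennreal (norm (\<Lambda> \<xi>)) \<partial>lebesgue)"
    unfolding nn_integral_completion by (rule nn_integral_cong_AE[OF AE_symmetric[OF g_eq]])
  also have "\<dots> \<le> (\<integral>\<^sup>+\<xi>. ennreal (norm (\<Lambda>1 \<xi>)) \<partial>lebesgue)"
  proof (rule nn_integral_mono_AE)
    have "\<Lambda>1 \<bar>\<xi>\<bar> = \<Lambda>1 \<xi>" for \<xi>
      using assms(2) by (auto simp: decreasing_radial_L1_majorant_def)
    then have "AE \<xi> in lebesgue. norm (\<Lambda> \<xi>) \<le> \<bar>\<Lambda>1 \<xi>\<bar>"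
      using assms(2) by (simp add: decreasing_radial_L1_majorant_def)
    then show "AE \<xi> in lebesgue. ennreal (norm (\<Lambda> \<xi>)) \<le> ennreal (norm (\<Lambda>1 \<xi>))"
      by eventually_elim (simp add: ennreal_leI)
  qed
  also have "\<dots> < \<infinity>"
    using assms(2) by (simp add: decreasing_radial_L1_majorant_def integrable_iff_bounded)
  finally have g_fin: "(\<integral>\<^sup>+\<xi>. g \<xi> \<partial>lborel) < \<infinity>" .
  let ?G = "\<lambda>\<xi>. \<integral>\<^sup>+n. ennreal (norm (fourier_measure_T \<nu> n)) * g (\<xi> - of_int n) \<partial>count_space UNIV"
  have "AE \<xi> in lborel. fourier_measure_R \<mu> \<xi> = W (fourier_measure_T \<nu>) \<Lambda> \<xi>"
    using assms(5) by (simp add: AE_completion_iff)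
  with norm_W_le[OF g_eq, of "fourier_measure_T \<nu>"]
  have G: "AE \<xi> in lborel. ennreal (norm (fourier_measure_R \<mu> \<xi>)) \<le> ?G \<xi>"
    by eventually_elim simp
  have "\<mu> {x} = 0" for x
  proof -
    let ?I = "\<lambda>N. \<integral>\<xi>. cis (2 * pi * x * \<xi>) * fourier_measure_R \<mu> \<xi> \<partial>unif (real (Suc N))"
    \<comment> \<open>The factor \<open>cis\<close> has modulus 1, and the almost everywhere bound
      passes to \<open>unif\<close>, which has a density.\<close>
    have le: "ennreal (norm (?I N)) \<le> (\<integral>\<^sup>+\<xi>. ?G \<xi> \<partial>unif (real (Suc N)))" for N
    proof -
      have "ennreal (norm (?I N)) \<le> (\<integral>\<^sup>+\<xi>. ennreal (norm (cis (2 * pi * x * \<xi>) * fourier_measure_R \<mu> \<xi>)) \<partial>unif (real (Suc N)))"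
        by (intro integral_norm_bound_ennreal fourier_measure_R_point_mass assms)
      also have "\<dots> \<le> (\<integral>\<^sup>+\<xi>. ?G \<xi> \<partial>unif (real (Suc N)))"
        using AE_unif[OF G] by (intro nn_integral_mono_AE) (simp add: norm_mult)
      finally show ?thesis .
    qed
    have lim: "(\<lambda>N. \<integral>\<^sup>+\<xi>. ?G \<xi> \<partial>unif (real (Suc N))) \<longlonglongrightarrow> 0"
      using g g_fin C mean by (intro periodization_tendsto_0) auto
    have "(\<lambda>N. ennreal (norm (?I N))) \<longlonglongrightarrow> 0"
      by (rule tendsto_sandwich[OF _ _ tendsto_const lim]) (use le in simp_all)
    \<comment> \<open>The same sequence also converges to the modulus of the point mass, so
      uniqueness of limits makes that mass 0.\<close>
    moreover have "(\<lambda>N. ennreal (norm (?I N))) \<longlonglongrightarrow> ennreal (norm (\<mu> {x}))"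
      by (intro tendsto_ennrealI tendsto_norm fourier_measure_R_point_mass assms)
    ultimately have "ennreal (norm (\<mu> {x})) = 0"
      using LIMSEQ_unique by blast
    then show ?thesis by simp
  qed
  then show ?thesis by (simp add: continuous_measure_def)
qed

end
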